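(* No free ultrafilter on $\mathbb{N}$ is weak $\ell_1$ complete.
   Context: A filter on $\mathbb{N}$ is free if it contains all subsets of $\mathbb{N}$ with finite complement. A sequence $(x_n)_{n\in\mathbb{N}}$ in a topological space $\mathcal{F}$-converges to $x$ if $\{n: x_n\in U\}\in\mathcal{F}$ for every neighborhood $U$ of $x$. The space $\ell_1$ is the real Banach space of absolutely summable sequences, regarded as a subspace of its bidual $\ell_1^{**}$ via the canonical embedding. A filter $\mathcal{F}$ on $\mathbb{N}$ is weak $\ell_1$ complete (a WC1-filter) if for every norm-bounded sequence $(x_n)\subset\ell_1$ that $\mathcal{F}$-converges in the topology $\sigma(\ell_1^{**},\ell_1^{*})$ to some $x\in\ell_1^{**}$, the limit $x$ in fact belongs to $\ell_1$. *)

theory Defs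
  imports "HOL-Analysis.Analysis"
begin

section \<open>The real Banach space of absolutely summable sequences\<close>

typedef ell1 = "{x :: nat \<Rightarrow> real. summable (\<lambda>n. \<bar>x n\<bar>)}"
  morphisms ell1_nth Abs_ell1
  by (rule exI[of _ "\<lambda>_. 0"]) simp

setup_lifting type_definition_ell1

lemma summable_ell1: "summable (\<lambda>n. \<bar>ell1_nth x n\<bar>)"
  using ell1_nth[of x] by simp

lemma ell1_eqI: "(\<And>n. ell1_nth x n = ell1_nth y n) \<Longrightarrow> x = y"
  by transfer auto

instantiation ell1 :: real_normed_vector
begin

lift_definition norm_ell1 :: "ell1 \<Rightarrow> real" is "\<lambda>x. \<Sum>n. \<bar>x n\<bar>" .

lift_definition zero_ell1 :: ell1 is "\<lambda>_. 0"
  by simp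

lift_definition plus_ell1 :: "ell1 \<Rightarrow> ell1 \<Rightarrow> ell1" is "\<lambda>x y n. x n + y n"
proof -
  fix x y :: "nat \<Rightarrow> real"
  assume s: "summable (\<lambda>n. \<bar>x n\<bar>)" "summable (\<lambda>n. \<bar>y n\<bar>)"
  show "summable (\<lambda>n. \<bar>x n + y n\<bar>)"
    by (rule summable_comparison_test'[OF summable_add[OF s], where N = 0])
       (auto intro: abs_triangle_ineq)
qed

lift_definition uminus_ell1 :: "ell1 \<Rightarrow> ell1" is "\<lambda>x n. - x n"
  by simp

lift_definition minus_ell1 :: "ell1 \<Rightarrow> ell1 \<Rightarrow> ell1" is "\<lambda>x y n. x n - y n"
proof -
  fix x y :: "nat \<Rightarrow> real"
  assume s: "summable (\<lambda>n. \<bar>x n\<bar>)" "summable (\<lambda>n. \<bar>y n\<bar>)"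
  show "summable (\<lambda>n. \<bar>x n - y n\<bar>)"
    by (rule summable_comparison_test'[OF summable_add[OF s], where N = 0])
       (auto intro: abs_triangle_ineq4)
qed

lift_definition scaleR_ell1 :: "real \<Rightarrow> ell1 \<Rightarrow> ell1" is "\<lambda>c x n. c * x n"
  by (simp add: abs_mult summable_mult)

definition dist_ell1 :: "ell1 \<Rightarrow> ell1 \<Rightarrow> real"
  where "dist_ell1 x y = norm (x - y)"

definition sgn_ell1 :: "ell1 \<Rightarrow> ell1"
  where "sgn_ell1 x = inverse (norm x) *\<^sub>R x"

definition [code del]:
  "(uniformity :: (ell1 \<times> ell1) filter) = (INF e\<in>{0 <..}. principal {(x, y). dist x y < e})"

definition open_ell1 :: "ell1 set \<Rightarrow> bool"
  where [code del]: "open_ell1 S = (\<forall>x\<in>S. \<forall>\<^sub>F (x', y) in uniformity. x' = x \<longrightarrow> y \<in> S)"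

instance
proof
  fix x y :: ell1 and c :: real
  show "norm x = 0 \<longleftrightarrow> x = 0"
    by transfer (auto simp: suminf_eq_zero_iff)
  show "norm (x + y) \<le> norm x + norm y"
  proof transfer
    fix x y :: "nat \<Rightarrow> real"
    assume s: "summable (\<lambda>n. \<bar>x n\<bar>)" "summable (\<lambda>n. \<bar>y n\<bar>)"
    have "summable (\<lambda>n. \<bar>x n + y n\<bar>)"
      by (rule summable_comparison_test'[OF summable_add[OF s], where N = 0])
         (auto intro: abs_triangle_ineq)
    then have "(\<Sum>n. \<bar>x n + y n\<bar>) \<le> (\<Sum>n. \<bar>x n\<bar> + \<bar>y n\<bar>)"
      by (intro suminf_le summable_add s) (auto intro: abs_triangle_ineq)
    then show "(\<Sum>n. \<bar>x n + y n\<bar>) \<le> (\<Sum>n. \<bar>x n\<bar>) + (\<Sum>n. \<bar>y n\<bar>)"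
      using suminf_add[OF s] by simp
  qed
  show "norm (c *\<^sub>R x) = \<bar>c\<bar> * norm x"
    by transfer (simp add: abs_mult suminf_mult)
qed (simp_all add: dist_ell1_def sgn_ell1_def uniformity_ell1_def open_ell1_def
      | (transfer, simp add: algebra_simps))+

end

lemma sum_le_norm_ell1: "(\<Sum>i<n. \<bar>ell1_nth x i\<bar>) \<le> norm x"
  by transfer (auto intro: sum_le_suminf)

lemma norm_ell1_nth_le: "\<bar>ell1_nth x n\<bar> \<le> norm x"
proof -
  have "\<bar>ell1_nth x n\<bar> \<le> (\<Sum>i<Suc n. \<bar>ell1_nth x i\<bar>)"
    by (simp add: sum_nonneg)
  then show ?thesis
    using sum_le_norm_ell1[of x "Suc n"] by linarith
qed

instance ell1 :: banach
proof
  fix X :: "nat \<Rightarrow> ell1"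
  assume X: "Cauchy X"
  have Cauchy_nth: "Cauchy (\<lambda>m. ell1_nth (X m) n)" for n
  proof (rule metric_CauchyI)
    fix e :: real
    assume "0 < e"
    then obtain M where M: "\<And>m k. m \<ge> M \<Longrightarrow> k \<ge> M \<Longrightarrow> dist (X m) (X k) < e"
      using metric_CauchyD[OF X] by blast
    have "dist (ell1_nth (X m) n) (ell1_nth (X k) n) \<le> dist (X m) (X k)" for m k
      using norm_ell1_nth_le[of "X m - X k" n]
      by (simp add: dist_norm minus_ell1.rep_eq)
    then show "\<exists>M. \<forall>m\<ge>M. \<forall>k\<ge>M. dist (ell1_nth (X m) n) (ell1_nth (X k) n) < e"
      using M by (meson le_less_trans)
  qed
  define y where "y = (\<lambda>n. lim (\<lambda>m. ell1_nth (X m) n))"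
  have y: "(\<lambda>m. ell1_nth (X m) n) \<longlonglongrightarrow> y n" for n
    using Cauchy_nth[of n] by (simp add: y_def Cauchy_convergent_iff convergent_LIMSEQ_iff)
  have tail: "(\<Sum>i<n. \<bar>ell1_nth (X m) i - y i\<bar>) \<le> e"
    if M: "\<And>k. k \<ge> M \<Longrightarrow> dist (X m) (X k) \<le> e" for m M e n
  proof (rule tendsto_upperbound)
    show "(\<lambda>k. \<Sum>i<n. \<bar>ell1_nth (X m) i - ell1_nth (X k) i\<bar>)
        \<longlonglongrightarrow> (\<Sum>i<n. \<bar>ell1_nth (X m) i - y i\<bar>)"
      by (intro tendsto_intros y)
    have "(\<Sum>i<n. \<bar>ell1_nth (X m) i - ell1_nth (X k) i\<bar>) \<le> e" if "k \<ge> M" for k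
      using sum_le_norm_ell1[of "X m - X k" n] M[OF that]
      by (simp add: dist_norm minus_ell1.rep_eq)
    then show "\<forall>\<^sub>F k in sequentially. (\<Sum>i<n. \<bar>ell1_nth (X m) i - ell1_nth (X k) i\<bar>) \<le> e"
      by (auto simp: eventually_sequentially)
  qed simp
  have summable_diff: "summable (\<lambda>i. \<bar>ell1_nth (X m) i - y i\<bar>)"
    and norm_diff: "(\<Sum>i. \<bar>ell1_nth (X m) i - y i\<bar>) \<le> e"
    if M: "\<And>k. k \<ge> M \<Longrightarrow> dist (X m) (X k) \<le> e" for m M e
  proof -
    show s: "summable (\<lambda>i. \<bar>ell1_nth (X m) i - y i\<bar>)"
    proof (rule bounded_imp_summable)
      show "(\<Sum>i\<le>n. \<bar>ell1_nth (X m) i - y i\<bar>) \<le> e" for n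
        using tail[of M m e "Suc n", OF M] by (simp only: lessThan_Suc_atMost)
    qed simp
    show "(\<Sum>i. \<bar>ell1_nth (X m) i - y i\<bar>) \<le> e"
      by (intro suminf_le_const s) (rule tail[of M m e, OF M])
  qed
  obtain M where M: "\<And>m k. m \<ge> M \<Longrightarrow> k \<ge> M \<Longrightarrow> dist (X m) (X k) < 1"
    using metric_CauchyD[OF X, of 1] by auto
  have "summable (\<lambda>i. \<bar>ell1_nth (X M) i\<bar> + \<bar>ell1_nth (X M) i - y i\<bar>)"
    by (intro summable_add summable_ell1 summable_diff[of M _ 1]) (simp add: M less_imp_le)
  then have "summable (\<lambda>i. \<bar>y i\<bar>)"
    by (rule summable_comparison_test'[where N = 0]) auto
  then have nth_Y: "ell1_nth (Abs_ell1 y) = y"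
    by (simp add: Abs_ell1_inverse)
  have "X \<longlonglongrightarrow> Abs_ell1 y"
  proof (rule metric_LIMSEQ_I)
    fix e :: real
    assume "0 < e"
    then obtain M where M: "\<And>m k. m \<ge> M \<Longrightarrow> k \<ge> M \<Longrightarrow> dist (X m) (X k) < e / 2"
      using metric_CauchyD[OF X, of "e / 2"] by auto
    have "dist (X m) (Abs_ell1 y) \<le> e / 2" if "m \<ge> M" for m
      using norm_diff[of M m "e / 2"] M[OF that]
      by (simp add: dist_norm norm_ell1.rep_eq minus_ell1.rep_eq nth_Y less_imp_le)
    then show "\<exists>M. \<forall>m\<ge>M. dist (X m) (Abs_ell1 y) < e"
      using \<open>0 < e\<close> by (intro exI[of _ M]) force
  qed
  then show "convergent X"
    by (auto simp: convergent_def)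
qed


section \<open>The bidual and its weak-star topology\<close>

text \<open>The dual of a real normed space \<open>'a\<close> is the type \<open>'a \<Rightarrow>\<^sub>L real\<close>, with the operator norm.\<close>

lift_definition canonical_embedding ::
    "'a::real_normed_vector \<Rightarrow> (('a \<Rightarrow>\<^sub>L real) \<Rightarrow>\<^sub>L real)"
  is "\<lambda>x f. blinfun_apply f x"
  by (rule blinfun.bounded_linear_left)

text \<open>
  For \<open>X = 'a\<close>, the weak-star topology on \<open>X*\<close> is the coarsest topology that makes all evaluations
  at points of \<open>X\<close> continuous. Instantiating \<open>'a\<close> with the dual of a space \<open>Y\<close> gives the
  topology \<open>\<sigma>(Y**, Y*)\<close> on the bidual.
\<close>

definition weak_star_topology :: "('a::real_normed_vector \<Rightarrow>\<^sub>L real) topology"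
  where "weak_star_topology =
    topology_generated_by {{\<phi>. blinfun_apply \<phi> f \<in> U} | f U. open U}"

lemma topspace_weak_star_topology [simp]: "topspace weak_star_topology = UNIV"
  unfolding weak_star_topology_def topology_generated_by_topspace by (auto intro!: exI[of _ UNIV])

lemma limitin_weak_star_topology:
  "limitin weak_star_topology x \<phi> F \<longleftrightarrow>
    (\<forall>f. ((\<lambda>n. blinfun_apply (x n) f) \<longlongrightarrow> blinfun_apply \<phi> f) F)"
proof
  assume L: "limitin weak_star_topology x \<phi> F"
  show "\<forall>f. ((\<lambda>n. blinfun_apply (x n) f) \<longlongrightarrow> blinfun_apply \<phi> f) F"
  proof (intro allI topological_tendstoI)
    fix f and U :: "real set"
    assume U: "open U" "blinfun_apply \<phi> f \<in> U"
    have "openin weak_star_topology {\<psi>. blinfun_apply \<psi> f \<in> U}"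
      unfolding weak_star_topology_def
      by (rule topology_generated_by_Basis) (use U in auto)
    then show "\<forall>\<^sub>F n in F. blinfun_apply (x n) f \<in> U"
      using L U(2) unfolding limitin_def by force
  qed
next
  assume R: "\<forall>f. ((\<lambda>n. blinfun_apply (x n) f) \<longlongrightarrow> blinfun_apply \<phi> f) F"
  have "\<forall>\<^sub>F n in F. x n \<in> U"
    if "generate_topology_on {{\<phi>. blinfun_apply \<phi> f \<in> U} | f U. open U} U" "\<phi> \<in> U" for U
    using that
  proof (induction rule: generate_topology_on.induct)
    case (Int a b)
    then show ?case by (auto intro: eventually_conj)
  next
    case (UN K)
    then obtain k where "k \<in> K" "\<phi> \<in> k" by blast
    with UN have "\<forall>\<^sub>F n in F. x n \<in> k" by simp
    then show ?case by (rule eventually_mono) (use \<open>k \<in> K\<close> in blast)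
  next
    case (Basis s)
    then show ?case using R by (auto dest!: topological_tendstoD)
  qed simp
  then show "limitin weak_star_topology x \<phi> F"
    by (auto simp: limitin_def weak_star_topology_def openin_topology_generated_by_iff
        topology_generated_by_topspace intro!: exI[of _ UNIV])
qed


section \<open>Free ultrafilters and weak \<open>\<ell>\<^sub>1\<close> complete filters\<close>

text \<open>
  A set \<open>A\<close> is a member of the filter \<open>F\<close> iff \<open>eventually (\<lambda>n. n \<in> A) F\<close>. The order on the type
  \<open>'a filter\<close> is reverse inclusion of the families of members, and \<open>bot\<close> is the improper
  filter, of which every set is a member. An ultrafilter is a proper filter that is not properly
  contained in another proper filter.
\<close>

definition free_filter :: "'a filter \<Rightarrow> bool"
  where "free_filter F \<longleftrightarrow> (\<forall>A. finite (- A) \<longrightarrow> eventually (\<lambda>n. n \<in> A) F)"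

definition ultrafilter :: "'a filter \<Rightarrow> bool"
  where "ultrafilter F \<longleftrightarrow> F \<noteq> bot \<and> (\<forall>G. G \<noteq> bot \<and> G \<le> F \<longrightarrow> G = F)"

lemma free_filter_iff: "free_filter F \<longleftrightarrow> F \<le> cofinite"
proof
  assume F: "free_filter F"
  show "F \<le> cofinite"
  proof (rule filter_leI)
    fix P :: "'a \<Rightarrow> bool"
    assume "eventually P cofinite"
    then have "finite (- {n. P n})"
      by (simp add: eventually_cofinite Compl_eq)
    with F have "eventually (\<lambda>n. n \<in> {n. P n}) F"
      unfolding free_filter_def by blast
    then show "eventually P F" by simp
  qed
next
  assume "F \<le> cofinite"
  then show "free_filter F"
    unfolding free_filter_def by (auto simp: le_filter_def eventually_cofinite Compl_eq)
qed

lemma ultrafilter_iff: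
  "ultrafilter F \<longleftrightarrow> F \<noteq> bot \<and> (\<forall>P. eventually P F \<or> eventually (\<lambda>n. \<not> P n) F)"
proof (intro iffI conjI allI)
  fix P
  assume U: "ultrafilter F"
  show "eventually P F \<or> eventually (\<lambda>n. \<not> P n) F"
  proof (rule disjCI)
    assume "\<not> eventually (\<lambda>n. \<not> P n) F"
    then have "inf F (principal {n. P n}) \<noteq> bot"
      by (simp add: trivial_limit_def eventually_inf_principal)
    then have "inf F (principal {n. P n}) = F"
      using U by (simp add: ultrafilter_def)
    moreover have "eventually P (inf F (principal {n. P n}))"
      by (simp add: eventually_inf_principal)
    ultimately show "eventually P F" by simp
  qed
next
  assume R: "F \<noteq> bot \<and> (\<forall>P. eventually P F \<or> eventually (\<lambda>n. \<not> P n) F)"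
  have "F \<le> G" if G: "G \<noteq> bot" "G \<le> F" for G
  proof (rule filter_leI)
    fix P
    assume P: "eventually P G"
    have "\<not> eventually (\<lambda>n. \<not> P n) F"
    proof
      assume "eventually (\<lambda>n. \<not> P n) F"
      then have "eventually (\<lambda>n. \<not> P n) G"
        using G(2) by (simp add: le_filter_def)
      with P have "eventually (\<lambda>_. False) G"
        by (rule eventually_elim2) simp
      with G(1) show False by (simp add: trivial_limit_def)
    qed
    with R show "eventually P F" by blast
  qed
  with R show "ultrafilter F"
    unfolding ultrafilter_def by (auto intro: antisym)
qed (simp add: ultrafilter_def)

definition WC1_filter :: "nat filter \<Rightarrow> bool"
  where "WC1_filter F \<longleftrightarrow>
    (\<forall>(x :: nat \<Rightarrow> ell1) (\<phi> :: (ell1 \<Rightarrow>\<^sub>L real) \<Rightarrow>\<^sub>L real).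
      bounded (range x) \<and> limitin weak_star_topology (\<lambda>n. canonical_embedding (x n)) \<phi> F
        \<longrightarrow> \<phi> \<in> range canonical_embedding)"

end

theory Submission
  imports Defs
begin

text \<open>
  Along an ultrafilter every bounded real sequence converges, so the unit vectors of \<open>\<ell>\<^sub>1\<close>
  have a weak-star limit in the bidual. Along a free filter this limit vanishes on every coordinate
  functional, so it could only be the zero vector of \<open>\<ell>\<^sub>1\<close>; but it takes the value
  \<open>1\<close> on the summation functional.
\<close>

text \<open>Compactness gives the image filter a cluster point in \<open>K\<close>. An ultrafilter
  decides every neighborhood of that point, which turns clustering into convergence.\<close>

lemma ultrafilter_tendsto_compact:
  assumes F: "ultrafilter F" and K: "compact K" and g: "eventually (\<lambda>n. g n \<in> K) F"
  shows "\<exists>l\<in>K. (g \<longlongrightarrow> l) F"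
proof -
  have "filtermap g F \<noteq> bot" "eventually (\<lambda>y. y \<in> K) (filtermap g F)"
    using F g by (simp_all add: ultrafilter_def filtermap_bot_iff eventually_filtermap)
  then obtain l where l: "l \<in> K" "inf (nhds l) (filtermap g F) \<noteq> bot"
    using K unfolding compact_filter by blast
  have "(g \<longlongrightarrow> l) F"
  proof (rule topological_tendstoI)
    fix U assume U: "open U" "l \<in> U"
    \<comment> \<open>Otherwise \<open>U\<close> and its complement would both belong to the
      infimum, contradicting that \<open>l\<close> is a cluster point.\<close>
    have False if "eventually (\<lambda>n. g n \<notin> U) F"
    proof -
      have "eventually (\<lambda>y. y \<in> U) (nhds l)" "eventually (\<lambda>y. y \<notin> U) (filtermap g F)"
        using U that by (auto simp: eventually_nhds eventually_filtermap)
      then have "eventually (\<lambda>_. False) (inf (nhds l) (filtermap g F))"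
        by (auto simp: eventually_inf)
      with l(2) show False by (simp add: trivial_limit_def)
    qed
    then show "eventually (\<lambda>n. g n \<in> U) F"
      using F unfolding ultrafilter_iff by blast
  qed
  with l(1) show ?thesis by blast
qed

text \<open>Banach-Alaoglu in ultrafilter form: the limit is taken pointwise, and linearity and the
  norm bound survive it.\<close>

lemma ultrafilter_weak_star_limit:
  fixes x :: "'b \<Rightarrow> 'a::real_normed_vector \<Rightarrow>\<^sub>L real"
  assumes F: "ultrafilter F" and x: "bounded (range x)"
  shows "\<exists>\<phi>. limitin weak_star_topology x \<phi> F"
proof -
  have nb: "F \<noteq> bot" using F by (simp add: ultrafilter_def)
  obtain B where B: "\<And>n. norm (x n) \<le> B"
    using x unfolding bounded_iff by blast
  have bound: "norm (blinfun_apply (x n) f) \<le> norm f * B" for n f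
    using norm_blinfun[of "x n" f] mult_right_mono[OF B[of n], of "norm f"]
    by (simp add: mult.commute)
  define L where "L f = Lim F (\<lambda>n. blinfun_apply (x n) f)" for f
  \<comment> \<open>For fixed \<open>f\<close> all values lie in a compact interval, so
    \<open>Lim\<close> in the definition of \<open>L\<close> is a genuine limit.\<close>
  have "\<exists>l. ((\<lambda>n. blinfun_apply (x n) f) \<longlongrightarrow> l) F" for f
    using ultrafilter_tendsto_compact[OF F compact_cball[of 0 "norm f * B"],
        of "\<lambda>n. blinfun_apply (x n) f"] bound by auto
  then have L: "((\<lambda>n. blinfun_apply (x n) f) \<longlongrightarrow> L f) F" for f
    unfolding L_def using tendsto_Lim[OF nb] by metis
  have "bounded_linear L"
  proof (rule bounded_linear_intro)
    show "L (f + g) = L f + L g" for f g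
      using tendsto_unique[OF nb L[of "f + g"]] tendsto_add[OF L[of f] L[of g]]
      by (simp add: blinfun.add_right)
    show "L (c *\<^sub>R f) = c *\<^sub>R L f" for c f
      using tendsto_unique[OF nb L[of "c *\<^sub>R f"]] tendsto_scaleR[OF tendsto_const L[of f], of c]
      by (simp add: blinfun.scaleR_right)
    show "norm (L f) \<le> norm f * B" for f
      by (rule tendsto_upperbound[OF tendsto_norm[OF L[of f]] _ nb])
         (use bound in \<open>auto intro: always_eventually\<close>)
  qed
  then have "limitin weak_star_topology x (Blinfun L) F"
    unfolding limitin_weak_star_topology using L by (simp add: bounded_linear_Blinfun_apply)
  then show ?thesis ..
qed

lemma norm_canonical_embedding_le: "norm (canonical_embedding x) \<le> norm x"
  by (rule norm_blinfun_bound)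
     (use norm_blinfun[of _ x] in \<open>simp_all add: canonical_embedding.rep_eq mult.commute[of "norm x"]
        del: real_norm_def\<close>)

lift_definition unit_ell1 :: "nat \<Rightarrow> ell1" is "\<lambda>k n. if n = k then 1 else 0"
  by (rule summable_finite[of "{k}" for k]) auto

lemma norm_unit_ell1: "norm (unit_ell1 k) = 1"
proof -
  have "(\<lambda>n. \<bar>if n = k then 1 else 0 :: real\<bar>) sums (\<Sum>n\<in>{k}. \<bar>if n = k then 1 else 0\<bar>)"
    by (rule sums_finite) auto
  then show ?thesis by (simp add: norm_ell1.rep_eq unit_ell1.rep_eq sums_iff)
qed

text \<open>The entries are nonnegative, so their sum is the norm.\<close>

lemma suminf_unit_ell1: "(\<Sum>n. ell1_nth (unit_ell1 k) n) = 1"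
  using norm_unit_ell1[of k]
  by (simp add: norm_ell1.rep_eq unit_ell1.rep_eq if_distrib[of abs] cong: if_cong)

lift_definition coord_ell1 :: "nat \<Rightarrow> ell1 \<Rightarrow>\<^sub>L real" is "\<lambda>k x. ell1_nth x k"
  by (rule bounded_linear_intro[where K = 1])
     (use norm_ell1_nth_le in \<open>simp_all add: plus_ell1.rep_eq scaleR_ell1.rep_eq\<close>)

text \<open>This is the constant sequence 1 of \<ell>-infinity, viewed as a functional. It detects
  mass escaping to infinity, which no single coordinate does.\<close>

lift_definition sum_ell1 :: "ell1 \<Rightarrow>\<^sub>L real" is "\<lambda>x. \<Sum>n. ell1_nth x n"
proof (rule bounded_linear_intro[where K = 1])
  have s: "summable (ell1_nth x)" for x
    using summable_ell1[of x] by (rule summable_rabs_cancel)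
  show "(\<Sum>n. ell1_nth (x + y) n) = (\<Sum>n. ell1_nth x n) + (\<Sum>n. ell1_nth y n)" for x y
    by (simp add: plus_ell1.rep_eq suminf_add[OF s s])
  show "(\<Sum>n. ell1_nth (c *\<^sub>R x) n) = c *\<^sub>R (\<Sum>n. ell1_nth x n)" for c x
    by (simp add: scaleR_ell1.rep_eq suminf_mult[OF s])
  show "norm (\<Sum>n. ell1_nth x n) \<le> norm x * 1" for x
    using summable_rabs[OF summable_ell1[of x]] by (simp add: norm_ell1.rep_eq)
qed

theorem theorem5p2:
  fixes F :: "nat filter"
  assumes "free_filter F" and "ultrafilter F"
  shows "\<not> WC1_filter F"
proof
  assume W: "WC1_filter F"
  have nb: "F \<noteq> bot" using assms(2) by (simp add: ultrafilter_def)
  have "bounded (range (\<lambda>n. canonical_embedding (unit_ell1 n)))"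
    unfolding bounded_iff using norm_canonical_embedding_le[of "unit_ell1 _"]
    by (auto simp: norm_unit_ell1)
  then obtain \<phi> where \<phi>: "limitin weak_star_topology (\<lambda>n. canonical_embedding (unit_ell1 n)) \<phi> F"
    using ultrafilter_weak_star_limit[OF assms(2)] by blast
  moreover have "bounded (range unit_ell1)"
    unfolding bounded_iff by (auto simp: norm_unit_ell1)
  ultimately obtain y where y: "\<phi> = canonical_embedding y"
    using W unfolding WC1_filter_def by blast
  \<comment> \<open>Since the limit is the image of \<open>y\<close>, weak-star convergence in the
    bidual becomes weak convergence of the unit vectors to \<open>y\<close>.\<close>
  have lim: "((\<lambda>n. blinfun_apply f (unit_ell1 n)) \<longlongrightarrow> blinfun_apply f y) F"
    for f :: "ell1 \<Rightarrow>\<^sub>L real"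
    using \<phi> unfolding limitin_weak_star_topology y by (simp add: canonical_embedding.rep_eq)
  have "ell1_nth y k = 0" for k
  proof -
    \<comment> \<open>Freeness enters here: only the unit vector with index \<open>k\<close> has a
      nonzero coordinate \<open>k\<close>, and this index may be discarded.\<close>
    have "eventually (\<lambda>n. n \<in> - {k}) F"
      using assms(1) by (auto simp only: free_filter_def double_compl finite.intros)
    then have "eventually (\<lambda>n. blinfun_apply (coord_ell1 k) (unit_ell1 n) = 0) F"
      by (rule eventually_mono) (auto simp: coord_ell1.rep_eq unit_ell1.rep_eq)
    then have "((\<lambda>n. blinfun_apply (coord_ell1 k) (unit_ell1 n)) \<longlongrightarrow> 0) F"
      by (rule tendsto_eventually)
    then show ?thesis
      using tendsto_unique[OF nb lim[of "coord_ell1 k"]] by (simp add: coord_ell1.rep_eq)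
  qed
  then have "y = 0"
    by (intro ell1_eqI) (simp add: zero_ell1.rep_eq)
  then have "blinfun_apply sum_ell1 y = 0"
    by simp
  \<comment> \<open>The functional is constantly 1 along the unit vectors, and limits along the
    proper filter \<open>F\<close> are unique.\<close>
  moreover have "blinfun_apply sum_ell1 y = 1"
    using tendsto_unique[OF nb lim[of sum_ell1]] by (simp add: sum_ell1.rep_eq suminf_unit_ell1)
  ultimately show False by simp
qed

end
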